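(* Let $S$ be a discrete group and let $\phi\colon\mathscr{X}\to\mathscr{Z}$, $\phi'\colon\mathscr{X}'\to\mathscr{Z}'$, $\sigma\colon\mathscr{X}'\to\mathscr{X}$, $\tau\colon\mathscr{Z}'\to\mathscr{Z}$ be extensions of minimal $S$-flows such that $\phi\circ\sigma=\tau\circ\phi'$, $\tau$ is highly proximal, and $\phi'$ is open. Then $(\sigma\times\sigma)[\mathrm{R}_{\phi'}]=\mathrm{R}_{\phi}$ if and only if the coordinate projection $\pi_X\colon\mathrm{R}_{\phi}\rightarrow X$, $(x_1,x_2)\mapsto x_1$, is semi-open. In particular, if $\phi$ is open or $\mathrm{R}_{\phi}$ contains a dense set of almost periodic points, then $(\sigma\times\sigma)[\mathrm{R}_{\phi'}]=\mathrm{R}_{\phi}$.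
   Context: Let $S$ be a discrete group with identity $e$. An $S$-flow $\mathscr{X}$ is a compact Hausdorff space $X$ with a map $S\times X\to X$, $(t,x)\mapsto tx$, such that $ex=x$, $(st)x=s(tx)$, and $x\mapsto tx$ is continuous for each $t\in S$. It is minimal if $\overline{Sx}=X$ for all $x$; a point $x$ is almost periodic if $S$ acts minimally on $\overline{Sx}$. An extension $\phi\colon\mathscr{X}\to\mathscr{Z}$ is a continuous onto map $X\to Z$ with $\phi(tx)=t\phi(x)$ for all $t\in S$, $x\in X$. $2^X$ is the space of nonempty closed subsets of $X$ with the Vietoris topology. An extension $\tau\colon\mathscr{Z}'\to\mathscr{Z}$ is highly proximal if for every $z\in Z$ there is a net $t_n\in S$ such that $t_n[\tau^{-1}(z)]$ converges to a singleton in $2^{Z'}$. For an extension $\phi\colon\mathscr{X}\to\mathscr{Z}$, $\mathrm{R}_\phi=\{(x_1,x_2)\in X\times X\mid\phi(x_1)=\phi(x_2)\}$, with the action $t(x_1,x_2)=(tx_1,tx_2)$. A continuous onto map $g\colon A\to B$ is semi-open if $\mathrm{int}_B\, g[U]\neq\emptyset$ for every nonempty open $U\subseteq A$. *)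

theory Defs
  imports "HOL-Analysis.Analysis" "HOL-Algebra.Group_Action"
begin

text \<open>Spaces are abstract topologies, so that orbit closures and relations are again flows on the
  same or a product type. The equations of an action are only required on the carrier of the group
  and on the points of the space. The group is discrete: no joint continuity is required.\<close>

definition flow :: "('s, 'm) monoid_scheme \<Rightarrow> 'x topology \<Rightarrow> ('s \<Rightarrow> 'x \<Rightarrow> 'x) \<Rightarrow> bool" where
  "flow S X a \<longleftrightarrow> group S \<and> compact_space X \<and> Hausdorff_space X \<and>
     (\<forall>t\<in>carrier S. continuous_map X X (a t)) \<and>
     (\<forall>x\<in>topspace X. a \<one>\<^bsub>S\<^esub> x = x) \<and>
     (\<forall>s\<in>carrier S. \<forall>t\<in>carrier S. \<forall>x\<in>topspace X. a (s \<otimes>\<^bsub>S\<^esub> t) x = a s (a t x))"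

definition minimal_flow ::
  "('s, 'm) monoid_scheme \<Rightarrow> 'x topology \<Rightarrow> ('s \<Rightarrow> 'x \<Rightarrow> 'x) \<Rightarrow> bool" where
  "minimal_flow S X a \<longleftrightarrow>
     flow S X a \<and> (\<forall>x\<in>topspace X. X closure_of (orbit S a x) = topspace X)"

definition almost_periodic ::
  "('s, 'm) monoid_scheme \<Rightarrow> 'x topology \<Rightarrow> ('s \<Rightarrow> 'x \<Rightarrow> 'x) \<Rightarrow> 'x \<Rightarrow> bool" where
  "almost_periodic S X a x \<longleftrightarrow>
     x \<in> topspace X \<and> minimal_flow S (subtopology X (X closure_of (orbit S a x))) a"

definition extension ::
  "('s, 'm) monoid_scheme \<Rightarrow> 'x topology \<Rightarrow> ('s \<Rightarrow> 'x \<Rightarrow> 'x) \<Rightarrow>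
     'z topology \<Rightarrow> ('s \<Rightarrow> 'z \<Rightarrow> 'z) \<Rightarrow> ('x \<Rightarrow> 'z) \<Rightarrow> bool" where
  "extension S X a Z b \<phi> \<longleftrightarrow>
     flow S X a \<and> flow S Z b \<and> continuous_map X Z \<phi> \<and> \<phi> ` topspace X = topspace Z \<and>
     (\<forall>t\<in>carrier S. \<forall>x\<in>topspace X. \<phi> (a t x) = b t (\<phi> x))"

definition vietoris :: "'x topology \<Rightarrow> 'x set topology" where
  "vietoris X = topology_generated_by
     ({{F. closedin X F \<and> F \<noteq> {} \<and> F \<subseteq> U} | U. openin X U} \<union>
      {{F. closedin X F \<and> F \<noteq> {} \<and> F \<inter> U \<noteq> {}} | U. openin X U})"

text \<open>A net in the group is rendered, as usual, by a proper filter containing the carrier: the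
  eventuality filter of a net converges where the net does, and a proper filter \<open>F\<close> arises from the
  net of pairs \<open>(A, t)\<close> with \<open>t \<in> A\<close>, \<open>A\<close> in \<open>F\<close>, directed by reverse inclusion.\<close>

definition highly_proximal ::
  "('s, 'm) monoid_scheme \<Rightarrow> 'x topology \<Rightarrow> ('s \<Rightarrow> 'x \<Rightarrow> 'x) \<Rightarrow>
     'z topology \<Rightarrow> ('s \<Rightarrow> 'z \<Rightarrow> 'z) \<Rightarrow> ('x \<Rightarrow> 'z) \<Rightarrow> bool" where
  "highly_proximal S X a Z b \<tau> \<longleftrightarrow> extension S X a Z b \<tau> \<and>
     (\<forall>z\<in>topspace Z. \<exists>(F :: 's filter) y. F \<noteq> bot \<and> (\<forall>\<^sub>F t in F. t \<in> carrier S) \<and>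
        limitin (vietoris X) (\<lambda>t. a t ` {x \<in> topspace X. \<tau> x = z}) {y} F)"

definition fibre_rel :: "'x topology \<Rightarrow> ('x \<Rightarrow> 'z) \<Rightarrow> ('x \<times> 'x) set" where
  "fibre_rel X \<phi> = {(x1, x2). x1 \<in> topspace X \<and> x2 \<in> topspace X \<and> \<phi> x1 = \<phi> x2}"

definition fibre_rel_space :: "'x topology \<Rightarrow> ('x \<Rightarrow> 'z) \<Rightarrow> ('x \<times> 'x) topology" where
  "fibre_rel_space X \<phi> = subtopology (prod_topology X X) (fibre_rel X \<phi>)"

definition diag_act :: "('s \<Rightarrow> 'x \<Rightarrow> 'x) \<Rightarrow> 's \<Rightarrow> 'x \<times> 'x \<Rightarrow> 'x \<times> 'x" where
  "diag_act a t = map_prod (a t) (a t)"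

definition semi_open_map :: "'a topology \<Rightarrow> 'b topology \<Rightarrow> ('a \<Rightarrow> 'b) \<Rightarrow> bool" where
  "semi_open_map A B g \<longleftrightarrow> continuous_map A B g \<and> g ` topspace A = topspace B \<and>
     (\<forall>U. openin A U \<and> U \<noteq> {} \<longrightarrow> B interior_of (g ` U) \<noteq> {})"

end

theory Submission
  imports Defs
begin

text \<open>
  Throughout, \<open>R\<close> denotes the fibre relation of \<open>\<phi>\<close>, \<open>R'\<close> that of \<open>\<phi>'\<close>, and \<open>\<pi>\<close> the first projection of
  \<open>R\<close> onto \<open>X\<close>. Two observations carry the proof.

  The first is that an equivariant map between minimal flows is semi-open
  (\<open>minimal_map_interior\<close>): finitely many translates of a closed set with nonempty interior cover the
  source, so finitely many translates of its closed image cover the target, and one of these must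
  have interior points. If \<open>\<phi>'\<close> is open, then so is the projection \<open>R' \<rightarrow> X'\<close>. Hence, if
  \<open>\<sigma> \<times> \<sigma>\<close> maps \<open>R'\<close> onto \<open>R\<close>, the composition \<open>R' \<rightarrow> X' \<rightarrow> X\<close> sends nonempty open sets to sets
  with interior points; it factors through \<open>\<pi>\<close>, which is therefore semi-open.

  The second is that, by high proximality and minimality, every nonempty open subset of \<open>Z'\<close>
  contains a whole fibre of \<open>\<tau>\<close> (\<open>highly_proximal_fibre_in_open\<close>). Let \<open>\<pi>\<close> be semi-open and let
  \<open>(U \<times> V) \<inter> R\<close> be nonempty. Some nonempty open \<open>I \<subseteq> U\<close> satisfies \<open>\<phi>(I) \<subseteq> \<phi>(V)\<close>. The set
  \<open>G = \<phi>'(\<sigma>\<inverse>(I))\<close> is open because \<open>\<phi>'\<close> is, so it contains the fibre \<open>\<tau>\<inverse>(z)\<close> of some \<open>z\<close>. This \<open>z\<close> lies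
  in \<open>\<tau>(G) = \<phi>(I)\<close>, so \<open>z = \<phi>(\<sigma>(v))\<close> for some \<open>v\<close> with \<open>\<sigma>(v) \<in> V\<close>. Now \<open>\<phi>'(v) \<in> \<tau>\<inverse>(z) \<subseteq> G\<close>, so \<open>\<phi>'(v)\<close> equals
  \<open>\<phi>'(u)\<close> with \<open>\<sigma>(u) \<in> I \<subseteq> U\<close>. Thus the image of \<open>R'\<close> meets \<open>U \<times> V\<close>; the image is dense in \<open>R\<close> and,
  being compact, it is all of \<open>R\<close>.

  If \<open>\<phi>\<close> is open, then \<open>\<pi>\<close> is open. If almost periodic points are dense in \<open>R\<close>, then every nonempty open
  subset of \<open>R\<close> meets a minimal subflow, and the first observation applies to the restriction of \<open>\<pi>\<close>
  to it. So \<open>\<pi>\<close> is semi-open in both cases.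
\<close>

section \<open>Minimal flows\<close>

lemma flow_point_closed:
  assumes "flow S X a" "t \<in> carrier S" "x \<in> topspace X"
  shows "a t x \<in> topspace X"
proof -
  have "continuous_map X X (a t)" using assms(1,2) by (simp add: flow_def)
  then show ?thesis using assms(3) continuous_map_image_subset_topspace[of X X "a t"] by blast
qed

lemma minimal_flow_orbit_meets_open:
  assumes "minimal_flow S X a" "openin X U" "U \<noteq> {}" "x \<in> topspace X"
  obtains t where "t \<in> carrier S" "a t x \<in> U"
proof -
  obtain u where u: "u \<in> U" using assms by blast
  then have "u \<in> X closure_of (orbit S a x)"
    using assms openin_subset[OF assms(2)] unfolding minimal_flow_def by blast
  then obtain y where "y \<in> orbit S a x" "y \<in> U"
    using u assms(2) by (auto simp: in_closure_of)
  then show thesis using that by (auto simp: orbit_def)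
qed

lemma minimal_flow_finite_translates_cover:
  assumes m: "minimal_flow S X a" and U: "openin X U" "U \<noteq> {}"
  obtains T where "finite T" "T \<subseteq> carrier S" "\<And>x. x \<in> topspace X \<Longrightarrow> \<exists>t\<in>T. a t x \<in> U"
proof -
  define P where "P t = {x \<in> topspace X. a t x \<in> U}" for t
  have c: "compact_space X" and cont: "\<And>t. t \<in> carrier S \<Longrightarrow> continuous_map X X (a t)"
    using m unfolding minimal_flow_def flow_def by auto
  have "\<exists>\<F>. finite \<F> \<and> \<F> \<subseteq> P ` carrier S \<and> topspace X \<subseteq> \<Union>\<F>"
  proof (rule compactinD)
    show "compactin X (topspace X)" using c by (simp add: compact_space_def)
    show "\<And>Q. Q \<in> P ` carrier S \<Longrightarrow> openin X Q"
      using openin_continuous_map_preimage[OF cont U(1)] by (auto simp: P_def)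
    show "topspace X \<subseteq> \<Union> (P ` carrier S)"
      using minimal_flow_orbit_meets_open[OF m U] unfolding P_def by blast
  qed
  then obtain T where T: "finite T" "T \<subseteq> carrier S" "topspace X \<subseteq> \<Union> (P ` T)"
    by (metis finite_subset_image)
  show thesis
    by (rule that[OF T(1,2)]) (use T(3) in \<open>auto simp: P_def\<close>)
qed

lemma flow_inverse_cancel:
  assumes f: "flow S X a" and t: "t \<in> carrier S" and x: "x \<in> topspace X"
  shows "a (inv\<^bsub>S\<^esub> t) (a t x) = x" "a t (a (inv\<^bsub>S\<^esub> t) x) = x"
proof -
  interpret group S using f by (simp add: flow_def)
  have i: "inv\<^bsub>S\<^esub> t \<in> carrier S" using t by simp
  show "a (inv\<^bsub>S\<^esub> t) (a t x) = x" "a t (a (inv\<^bsub>S\<^esub> t) x) = x"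
    using f t i x r_inv[OF t] l_inv[OF t] unfolding flow_def by metis+
qed

lemma flow_translation_open_map:
  assumes f: "flow S X a" and t: "t \<in> carrier S"
  shows "open_map X X (a t)"
proof -
  interpret group S using f by (simp add: flow_def)
  have i: "inv\<^bsub>S\<^esub> t \<in> carrier S" using t by simp
  have "homeomorphic_maps X X (a t) (a (inv\<^bsub>S\<^esub> t))"
    using f t i flow_inverse_cancel[OF f t] by (simp add: homeomorphic_maps_def flow_def)
  then have "homeomorphic_map X X (a t)" by (simp add: homeomorphic_maps_map)
  then show ?thesis by (rule homeomorphic_imp_open_map)
qed

text \<open>The finite case of the Baire category theorem: a finite union of nowhere dense closed sets has empty
  interior in every topological space.\<close>

lemma finite_closed_cover_interior:
  assumes "finite T" "\<And>t. t \<in> T \<Longrightarrow> closedin X (C t)" "topspace X \<noteq> {}" "topspace X \<subseteq> (\<Union>t\<in>T. C t)"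
  obtains t where "t \<in> T" "X interior_of (C t) \<noteq> {}"
proof -
  have "X interior_of (\<Union>t\<in>T. C t) = {} \<longleftrightarrow> (\<forall>t\<in>T. X interior_of (C t) = {})"
    using assms(1,2) by (induction T) (simp_all add: interior_of_union_eq_empty)
  moreover have "topspace X \<subseteq> X interior_of (\<Union>t\<in>T. C t)"
    using assms(4) by (simp add: interior_of_maximal)
  ultimately show thesis using that assms(3) by blast
qed

text \<open>The image is closed and contains an orbit, which is dense.\<close>

lemma equivariant_map_into_minimal_onto:
  assumes fY: "flow S Y b" and mX: "minimal_flow S X a" and cf: "continuous_map Y X f"
    and eq: "\<And>t y. t \<in> carrier S \<Longrightarrow> y \<in> topspace Y \<Longrightarrow> f (b t y) = a t (f y)"
    and ne: "topspace Y \<noteq> {}"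
  shows "f ` topspace Y = topspace X"
proof
  show sub: "f ` topspace Y \<subseteq> topspace X" using cf by (rule continuous_map_image_subset_topspace)
  obtain y where y: "y \<in> topspace Y" using ne by blast
  have "compactin X (f ` topspace Y)"
    using image_compactin[OF _ cf] fY by (simp add: flow_def compact_space_def)
  then have cl: "closedin X (f ` topspace Y)"
    using mX by (simp add: minimal_flow_def flow_def compactin_imp_closedin)
  have "b t y \<in> topspace Y" if "t \<in> carrier S" for t
    by (rule flow_point_closed[OF fY that y])
  then have "orbit S a (f y) \<subseteq> f ` topspace Y"
    using eq[OF _ y] unfolding orbit_def by (smt (verit) image_eqI mem_Collect_eq subsetI)
  then have "X closure_of (orbit S a (f y)) \<subseteq> f ` topspace Y"
    using cl closure_of_minimal by blast
  then show "topspace X \<subseteq> f ` topspace Y"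
    using mX y sub unfolding minimal_flow_def by blast
qed

text \<open>Semi-openness of factor maps of minimal flows. Shrinking the open set to a closed one inside it
  makes the images of its translates closed, so that \<open>finite_closed_cover_interior\<close> applies to the
  translates covering the target; translating back is a homeomorphism.\<close>

lemma minimal_map_interior:
  assumes mY: "minimal_flow S Y b" and mX: "minimal_flow S X a" and cf: "continuous_map Y X f"
    and eq: "\<And>t y. t \<in> carrier S \<Longrightarrow> y \<in> topspace Y \<Longrightarrow> f (b t y) = a t (f y)"
    and U: "openin Y U" "U \<noteq> {}"
  shows "X interior_of (f ` U) \<noteq> {}"
proof -
  have fY: "flow S Y b" and fX: "flow S X a" using mY mX by (auto simp: minimal_flow_def)
  have neY: "topspace Y \<noteq> {}" using U(2) openin_subset[OF U(1)] by blast
  have onto: "f ` topspace Y = topspace X"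
    by (rule equivariant_map_into_minimal_onto[OF fY mX cf _ neY]) (rule eq)
  have "regular_space Y" using fY by (simp add: flow_def compact_Hausdorff_imp_regular_space)
  then have nb: "neighbourhood_base_of (closedin Y) Y" by (simp add: neighbourhood_base_of_closedin)
  obtain u where "u \<in> U" using U(2) by blast
  then obtain V C where V: "openin Y V" "V \<noteq> {}" and C: "closedin Y C" and VC: "V \<subseteq> C" "C \<subseteq> U"
    using nb[unfolded neighbourhood_base_of, rule_format, of U u] U(1) by blast
  have "compactin X (f ` C)"
    using image_compactin[OF _ cf] closedin_compact_space[OF _ C] fY by (simp add: flow_def)
  then have fC: "closedin X (f ` C)"
    using fX by (simp add: flow_def compactin_imp_closedin)
  obtain T where T: "finite T" "T \<subseteq> carrier S" "\<And>y. y \<in> topspace Y \<Longrightarrow> \<exists>t\<in>T. b t y \<in> V"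
    using minimal_flow_finite_translates_cover[OF mY V] by metis
  define D where "D t = {x \<in> topspace X. a t x \<in> f ` C}" for t
  have cD: "closedin X (D t)" if "t \<in> T" for t
    unfolding D_def using that T(2) fX fC
    by (intro closedin_continuous_map_preimage) (auto simp: flow_def)
  have "topspace X \<subseteq> (\<Union>t\<in>T. D t)"
  proof
    fix x assume x: "x \<in> topspace X"
    then obtain y where y: "y \<in> topspace Y" "x = f y" using onto by blast
    then obtain t where t: "t \<in> T" "b t y \<in> V" using T(3) by blast
    have "t \<in> carrier S" using t(1) T(2) by blast
    then have "a t x = f (b t y)" using eq[of t y] y by simp
    moreover have "b t y \<in> C" using t(2) VC(1) by blast
    ultimately have "x \<in> D t" using x by (simp add: D_def)
    then show "x \<in> (\<Union>t\<in>T. D t)" using t(1) by blast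
  qed
  moreover have "topspace X \<noteq> {}" using onto neY by blast
  ultimately obtain t where t: "t \<in> T" "X interior_of (D t) \<noteq> {}"
    using finite_closed_cover_interior[of T X D, OF T(1) cD] by blast
  define I where "I = a t ` (X interior_of (D t))"
  have "open_map X X (a t)" using flow_translation_open_map[OF fX] t T(2) by blast
  then have "openin X I" by (simp add: I_def open_map_def)
  moreover have "I \<subseteq> f ` U"
    using interior_of_subset[of X "D t"] VC unfolding I_def D_def by blast
  moreover have "I \<noteq> {}" using t by (simp add: I_def)
  ultimately show ?thesis by (meson interior_of_eq_empty)
qed

section \<open>Fibres of highly proximal extensions\<close>

text \<open>Some translates of a fibre shrink to a point, which minimality moves into the given open set. As the
  map is equivariant, a translate of a fibre is a fibre.\<close>

lemma highly_proximal_fibre_in_open: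
  assumes hp: "highly_proximal S X a Z b \<tau>" and m: "minimal_flow S X a"
    and U: "openin X U" "U \<noteq> {}"
  obtains z where "z \<in> topspace Z" "{x \<in> topspace X. \<tau> x = z} \<subseteq> U"
proof -
  have fX: "flow S X a" and fZ: "flow S Z b" and onto: "\<tau> ` topspace X = topspace Z"
    and eq: "\<And>t x. t \<in> carrier S \<Longrightarrow> x \<in> topspace X \<Longrightarrow> \<tau> (a t x) = b t (\<tau> x)"
    using hp unfolding highly_proximal_def extension_def by auto
  interpret group S using fX by (simp add: flow_def)
  have clX: "a t x \<in> topspace X" if "t \<in> carrier S" "x \<in> topspace X" for t x
    by (rule flow_point_closed[OF fX that])
  have clZ: "b t z \<in> topspace Z" if "t \<in> carrier S" "z \<in> topspace Z" for t z
    by (rule flow_point_closed[OF fZ that])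
  define E where "E z = {x \<in> topspace X. \<tau> x = z}" for z
  obtain z0 where z0: "z0 \<in> topspace Z" using U(2) onto openin_subset[OF U(1)] by blast
  obtain F y where F: "F \<noteq> (bot :: 'a filter)" "\<forall>\<^sub>F t in F. t \<in> carrier S"
    and lim: "limitin (vietoris X) (\<lambda>t. a t ` E z0) {y} F"
    using hp z0 unfolding highly_proximal_def E_def by blast
  have y: "y \<in> topspace X"
    using limitin_topspace[OF lim] closedin_subset[of X "{y}"] unfolding vietoris_def by auto
  obtain s where s: "s \<in> carrier S" "a s y \<in> U"
    using minimal_flow_orbit_meets_open[OF m U y] by blast
  define W where "W = {x \<in> topspace X. a s x \<in> U}"
  have W: "openin X W"
    unfolding W_def using fX s U by (intro openin_continuous_map_preimage) (auto simp: flow_def)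
  define N where "N = {F. closedin X F \<and> F \<noteq> {} \<and> F \<subseteq> W}"
  have "openin (vietoris X) N"
    unfolding vietoris_def N_def by (rule topology_generated_by_Basis) (use W in blast)
  moreover have "{y} \<in> N"
    using y s fX closedin_Hausdorff_singleton unfolding N_def W_def flow_def by fastforce
  ultimately have "\<forall>\<^sub>F t in F. a t ` E z0 \<in> N" using lim unfolding limitin_def by blast
  with F(2) have "\<forall>\<^sub>F t in F. t \<in> carrier S \<and> a t ` E z0 \<in> N" by (rule eventually_conj)
  then obtain t where t: "t \<in> carrier S" "a t ` E z0 \<subseteq> W"
    using eventually_happens'[OF F(1)] unfolding N_def by blast
  define g where "g = s \<otimes>\<^bsub>S\<^esub> t"
  have g: "g \<in> carrier S" using s t by (simp add: g_def)
  have "E (b g z0) \<subseteq> U"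
  proof
    fix x assume "x \<in> E (b g z0)"
    then have x: "x \<in> topspace X" "\<tau> x = b g z0" by (auto simp: E_def)
    \<comment> \<open>Pull \<open>x\<close> back to the fibre over \<open>z0\<close> and push it forward in two steps, through \<open>W\<close>.\<close>
    define w where "w = a (inv\<^bsub>S\<^esub> g) x"
    have w: "w \<in> topspace X" using clX g x by (simp add: w_def)
    have "\<tau> w = b (inv\<^bsub>S\<^esub> g) (b g z0)"
      using eq[of "inv\<^bsub>S\<^esub> g" x] g x by (simp add: w_def)
    also have "\<dots> = z0" by (rule flow_inverse_cancel(1)[OF fZ g z0])
    finally have "a t w \<in> W" using t w by (auto simp: E_def)
    moreover have "a s (a t w) = a g w" using fX s t w unfolding g_def flow_def by metis
    moreover have "a g w = x" unfolding w_def by (rule flow_inverse_cancel(2)[OF fX g x(1)])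
    ultimately show "x \<in> U" by (simp add: W_def)
  qed
  then show thesis using that clZ[OF g z0] unfolding E_def by blast
qed

section \<open>Fibre relations\<close>

lemma fibre_rel_subset: "fibre_rel X \<phi> \<subseteq> topspace (prod_topology X X)"
  by (auto simp: fibre_rel_def)

lemma topspace_fibre_rel_space [simp]: "topspace (fibre_rel_space X \<phi>) = fibre_rel X \<phi>"
  using fibre_rel_subset[of X \<phi>] by (auto simp: fibre_rel_space_def)

lemma continuous_map_fst_fibre_rel: "continuous_map (fibre_rel_space X \<phi>) X fst"
  unfolding fibre_rel_space_def
  by (rule continuous_map_from_subtopology) (rule continuous_map_fst)

lemma fst_fibre_rel: "fst ` fibre_rel X \<phi> = topspace X"
  by (force simp: fibre_rel_def)

lemma openin_fibre_rel_box:
  assumes "openin (fibre_rel_space X \<phi>) W" "(x, y) \<in> W"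
  obtains U V where "openin X U" "openin X V" "x \<in> U" "y \<in> V" "(U \<times> V) \<inter> fibre_rel X \<phi> \<subseteq> W"
proof -
  obtain W' where W': "openin (prod_topology X X) W'" "W = W' \<inter> fibre_rel X \<phi>"
    using assms(1) unfolding fibre_rel_space_def openin_subtopology by blast
  have "(x, y) \<in> W'" using assms(2) W'(2) by blast
  then obtain U V where UV: "openin X U" "openin X V" "x \<in> U" "y \<in> V" and "U \<times> V \<subseteq> W'"
    using W'(1)[unfolded openin_prod_topology_alt, rule_format, of x y] by auto
  then have "(U \<times> V) \<inter> fibre_rel X \<phi> \<subseteq> W" using W'(2) by blast
  then show thesis by (rule that[OF UV])
qed

lemma openin_fibre_rel_spaceI:
  assumes "openin X U" "openin X V"
  shows "openin (fibre_rel_space X \<phi>) ((U \<times> V) \<inter> fibre_rel X \<phi>)"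
  using assms unfolding fibre_rel_space_def openin_subtopology
  by (metis openin_prod_Times_iff)

lemma compactin_fibre_rel:
  assumes "compact_space X" "Hausdorff_space Z" "continuous_map X Z \<phi>"
  shows "compactin (prod_topology X X) (fibre_rel X \<phi>)"
proof -
  have "continuous_map (prod_topology X X) Z (\<phi> \<circ> fst)" "continuous_map (prod_topology X X) Z (\<phi> \<circ> snd)"
    using continuous_map_compose[OF continuous_map_fst assms(3)]
      continuous_map_compose[OF continuous_map_snd assms(3)] by auto
  then have "closedin (prod_topology X X)
      {p \<in> topspace (prod_topology X X). (\<phi> \<circ> fst) p = (\<phi> \<circ> snd) p}"
    by (rule closedin_continuous_maps_eq[OF assms(2)])
  also have "{p \<in> topspace (prod_topology X X). (\<phi> \<circ> fst) p = (\<phi> \<circ> snd) p} = fibre_rel X \<phi>"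
    by (auto simp: fibre_rel_def)
  finally show ?thesis
    using assms(1) by (simp add: closedin_compact_space compact_space_prod_topology)
qed

text \<open>The projection of \<open>(U \<times> V) \<inter> R\<close> is \<open>U \<inter> \<phi>\<inverse>(\<phi>(V))\<close>.\<close>

lemma open_map_fst_fibre_rel:
  assumes c: "continuous_map X Z \<phi>" and o: "open_map X Z \<phi>"
  shows "open_map (fibre_rel_space X \<phi>) X fst"
  unfolding open_map_def
proof (intro allI impI)
  fix W assume W: "openin (fibre_rel_space X \<phi>) W"
  show "openin X (fst ` W)"
  proof (subst openin_subopen, intro ballI)
    fix x assume "x \<in> fst ` W"
    then obtain y where xy: "(x, y) \<in> W" by auto
    then have R: "x \<in> topspace X" "\<phi> x = \<phi> y"
      using openin_subset[OF W] by (auto simp: fibre_rel_def)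
    obtain U V where UV: "openin X U" "openin X V" "x \<in> U" "y \<in> V" "(U \<times> V) \<inter> fibre_rel X \<phi> \<subseteq> W"
      using openin_fibre_rel_box[OF W xy] by blast
    define N where "N = U \<inter> {x \<in> topspace X. \<phi> x \<in> \<phi> ` V}"
    have "openin X {x \<in> topspace X. \<phi> x \<in> \<phi> ` V}"
      using o UV(2) by (intro openin_continuous_map_preimage[OF c]) (simp add: open_map_def)
    then have "openin X N" unfolding N_def using UV(1) by blast
    moreover have "x \<in> N" using R UV by (auto simp: N_def)
    moreover have "N \<subseteq> fst ` W"
    proof
      fix u assume "u \<in> N"
      then obtain v where v: "u \<in> U" "u \<in> topspace X" "v \<in> V" "\<phi> u = \<phi> v" by (auto simp: N_def)
      moreover have "v \<in> topspace X" using v(3) openin_subset[OF UV(2)] by blast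
      ultimately have "(u, v) \<in> W" using UV(5) by (auto simp: fibre_rel_def)
      then show "u \<in> fst ` W" by force
    qed
    ultimately show "\<exists>T. openin X T \<and> x \<in> T \<and> T \<subseteq> fst ` W" by blast
  qed
qed

lemma semi_open_fst_fibre_relI:
  assumes "\<And>W. openin (fibre_rel_space X \<phi>) W \<Longrightarrow> W \<noteq> {} \<Longrightarrow> X interior_of (fst ` W) \<noteq> {}"
  shows "semi_open_map (fibre_rel_space X \<phi>) X fst"
  using assms unfolding semi_open_map_def
  by (simp add: continuous_map_fst_fibre_rel fst_fibre_rel)

lemma semi_open_fst_if_open:
  assumes "continuous_map X Z \<phi>" "open_map X Z \<phi>"
  shows "semi_open_map (fibre_rel_space X \<phi>) X fst"
proof (rule semi_open_fst_fibre_relI)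
  fix W assume "openin (fibre_rel_space X \<phi>) W" "W \<noteq> {}"
  then show "X interior_of (fst ` W) \<noteq> {}"
    using open_map_fst_fibre_rel[OF assms] by (simp add: open_map_def interior_of_openin)
qed

text \<open>The projection restricts to a map of minimal flows on the orbit closure of each almost
  periodic point, and \<open>minimal_map_interior\<close> applies to the trace of the open set on it.\<close>

lemma semi_open_fst_if_dense_almost_periodic:
  assumes mX: "minimal_flow S X a"
    and D: "D \<subseteq> {p. almost_periodic S (fibre_rel_space X \<phi>) (diag_act a) p}"
    and dense: "fibre_rel_space X \<phi> closure_of D = topspace (fibre_rel_space X \<phi>)"
  shows "semi_open_map (fibre_rel_space X \<phi>) X fst"
proof (rule semi_open_fst_fibre_relI)
  let ?R = "fibre_rel_space X \<phi>"
  fix W assume W: "openin ?R W" "W \<noteq> {}"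
  then obtain w where w: "w \<in> W" by blast
  then have "w \<in> ?R closure_of D" using dense openin_subset[OF W(1)] by blast
  then obtain p where p: "p \<in> D" "p \<in> W" using w W(1) by (auto simp: in_closure_of)
  define M where "M = ?R closure_of (orbit S (diag_act a) p)"
  have pR: "p \<in> topspace ?R" and mM: "minimal_flow S (subtopology ?R M) (diag_act a)"
    using p(1) D unfolding almost_periodic_def M_def by auto
  have pX: "fst p \<in> topspace X" "snd p \<in> topspace X"
    using pR by (auto simp: fibre_rel_def)
  have S: "\<one>\<^bsub>S\<^esub> \<in> carrier S" "\<And>x. x \<in> topspace X \<Longrightarrow> a \<one>\<^bsub>S\<^esub> x = x"
    using mX group.is_monoid monoid.one_closed unfolding minimal_flow_def flow_def by blast+
  have "diag_act a \<one>\<^bsub>S\<^esub> p = p"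
    using pX S(2) by (simp add: diag_act_def map_prod_def split_beta)
  then have "p \<in> orbit S (diag_act a) p" using S(1) unfolding orbit_def by force
  then have "p \<in> M" using pR closure_of_subset_Int unfolding M_def by fastforce
  have "X interior_of (fst ` (W \<inter> M)) \<noteq> {}"
  proof (rule minimal_map_interior[OF mM mX])
    show "continuous_map (subtopology ?R M) X fst"
      by (rule continuous_map_from_subtopology) (rule continuous_map_fst_fibre_rel)
    show "openin (subtopology ?R M) (W \<inter> M)" using W by (auto simp: openin_subtopology)
    show "W \<inter> M \<noteq> {}" using p(2) \<open>p \<in> M\<close> by blast
  qed (auto simp: diag_act_def)
  then show "X interior_of (fst ` W) \<noteq> {}"
    using interior_of_mono[of "fst ` (W \<inter> M)" "fst ` W" X] by blast
qed

section \<open>Lifting the fibre relation\<close>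

lemma semi_open_fst_if_fibre_rel_image:
  assumes mX: "minimal_flow S X a" and mX': "minimal_flow S X' a'"
    and \<sigma>: "extension S X' a' X a \<sigma>"
    and \<phi>': "continuous_map X' Z' \<phi>'" "open_map X' Z' \<phi>'"
    and onto: "map_prod \<sigma> \<sigma> ` fibre_rel X' \<phi>' = fibre_rel X \<phi>"
  shows "semi_open_map (fibre_rel_space X \<phi>) X fst"
proof (rule semi_open_fst_fibre_relI)
  fix W assume W: "openin (fibre_rel_space X \<phi>) W" "W \<noteq> {}"
  have c\<sigma>: "continuous_map X' X \<sigma>"
    and eq: "\<And>t x. t \<in> carrier S \<Longrightarrow> x \<in> topspace X' \<Longrightarrow> \<sigma> (a' t x) = a t (\<sigma> x)"
    using \<sigma> unfolding extension_def by auto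
  obtain x y where xy: "(x, y) \<in> W" using W(2) by auto
  obtain U V where UV: "openin X U" "openin X V" "x \<in> U" "y \<in> V" "(U \<times> V) \<inter> fibre_rel X \<phi> \<subseteq> W"
    using openin_fibre_rel_box[OF W(1) xy] by blast
  have "(x, y) \<in> fibre_rel X \<phi>" using xy openin_subset[OF W(1)] by auto
  then obtain u v where uv: "(u, v) \<in> fibre_rel X' \<phi>'" "\<sigma> u = x" "\<sigma> v = y"
    unfolding onto[symmetric] by auto
  define U' where "U' = {u \<in> topspace X'. \<sigma> u \<in> U}"
  define V' where "V' = {v \<in> topspace X'. \<sigma> v \<in> V}"
  have o: "openin X' U'" "openin X' V'"
    unfolding U'_def V'_def using openin_continuous_map_preimage[OF c\<sigma>] UV by auto
  define W' where "W' = (U' \<times> V') \<inter> fibre_rel X' \<phi>'"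
  have "openin X' (fst ` W')"
    using open_map_fst_fibre_rel[OF \<phi>'] openin_fibre_rel_spaceI[OF o] unfolding open_map_def W'_def
    by blast
  moreover have "(u, v) \<in> W'" using uv UV unfolding W'_def U'_def V'_def fibre_rel_def by auto
  then have "fst ` W' \<noteq> {}" by blast
  ultimately have "X interior_of (\<sigma> ` fst ` W') \<noteq> {}"
    using minimal_map_interior[OF mX' mX c\<sigma>, of "fst ` W'"] eq by blast
  moreover have "\<sigma> ` fst ` W' \<subseteq> fst ` W"
  proof -
    have "map_prod \<sigma> \<sigma> ` W' \<subseteq> W"
      using UV(5) onto unfolding W'_def U'_def V'_def by fastforce
    then show ?thesis by force
  qed
  ultimately show "X interior_of (fst ` W) \<noteq> {}"
    using interior_of_mono[of "\<sigma> ` fst ` W'" "fst ` W" X] by blast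
qed

text \<open>A box meeting \<open>R\<close> also meets the image of \<open>R'\<close>. Semi-openness provides an open set of
  \<open>x\<close> in \<open>U\<close> with partners in \<open>V\<close>; the fibre from \<open>highly_proximal_fibre_in_open\<close> compensates for
  lifts \<open>u\<close>, \<open>v\<close> of such partners having different images in \<open>Z'\<close>.\<close>

lemma fibre_rel_image_meets_box:
  assumes mX': "minimal_flow S X' a'" and mZ': "minimal_flow S Z' b'"
    and \<sigma>: "continuous_map X' X \<sigma>" "\<sigma> ` topspace X' = topspace X"
    and \<phi>': "continuous_map X' Z' \<phi>'" "\<phi>' ` topspace X' = topspace Z'" "open_map X' Z' \<phi>'"
    and comm: "\<And>x. x \<in> topspace X' \<Longrightarrow> \<phi> (\<sigma> x) = \<tau> (\<phi>' x)"
    and hp: "highly_proximal S Z' b' Z b \<tau>"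
    and so: "semi_open_map (fibre_rel_space X \<phi>) X fst"
    and UV: "openin X U" "openin X V" "(U \<times> V) \<inter> fibre_rel X \<phi> \<noteq> {}"
  shows "(U \<times> V) \<inter> map_prod \<sigma> \<sigma> ` fibre_rel X' \<phi>' \<noteq> {}"
proof -
  define I where "I = X interior_of (fst ` ((U \<times> V) \<inter> fibre_rel X \<phi>))"
  have I: "openin X I" "I \<noteq> {}"
    using so openin_fibre_rel_spaceI[OF UV(1,2)] UV(3) unfolding semi_open_map_def I_def by auto
  have I_sub: "I \<subseteq> fst ` ((U \<times> V) \<inter> fibre_rel X \<phi>)" unfolding I_def by (rule interior_of_subset)
  define G where "G = \<phi>' ` {u \<in> topspace X'. \<sigma> u \<in> I}"
  have "openin X' {u \<in> topspace X'. \<sigma> u \<in> I}"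
    using openin_continuous_map_preimage[OF \<sigma>(1) I(1)] .
  then have oG: "openin Z' G" using \<phi>'(3) by (simp add: G_def open_map_def)
  obtain i where i: "i \<in> I" using I(2) by blast
  then have "i \<in> \<sigma> ` topspace X'" using \<sigma>(2) openin_subset[OF I(1)] by blast
  then have neG: "G \<noteq> {}" using i by (auto simp: G_def)
  obtain z where z: "z \<in> topspace Z" "{y \<in> topspace Z'. \<tau> y = z} \<subseteq> G"
    by (rule highly_proximal_fibre_in_open[OF hp mZ' oG neG])
  have "\<tau> ` topspace Z' = topspace Z" using hp by (simp add: highly_proximal_def extension_def)
  then obtain y where y: "y \<in> topspace Z'" "\<tau> y = z" using z(1) by (metis imageE)
  then have "y \<in> G" using z(2) by blast
  then obtain u0 where u0: "u0 \<in> topspace X'" "\<sigma> u0 \<in> I" "\<phi>' u0 = y" by (auto simp: G_def)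
  have "\<sigma> u0 \<in> fst ` ((U \<times> V) \<inter> fibre_rel X \<phi>)" using u0(2) I_sub by blast
  then obtain x2 where x2: "x2 \<in> V" "x2 \<in> topspace X" "\<phi> (\<sigma> u0) = \<phi> x2"
    by (auto simp: fibre_rel_def)
  obtain v where v: "v \<in> topspace X'" "\<sigma> v = x2" using x2(2) \<sigma>(2) by (metis imageE)
  have "\<tau> (\<phi>' v) = z" using comm[OF v(1)] comm[OF u0(1)] v(2) u0(3) x2(3) y(2) by simp
  moreover have "\<phi>' v \<in> topspace Z'" using imageI[OF v(1), of \<phi>'] \<phi>'(2) by simp
  ultimately have "\<phi>' v \<in> G" using z(2) by blast
  \<comment> \<open>\<open>u0\<close> and \<open>v\<close> need not be related; replace \<open>u0\<close> by a point over \<open>I\<close> in the fibre of \<open>v\<close>.\<close>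
  then obtain u where u: "u \<in> topspace X'" "\<sigma> u \<in> I" "\<phi>' u = \<phi>' v" by (auto simp: G_def)
  have "\<sigma> u \<in> fst ` ((U \<times> V) \<inter> fibre_rel X \<phi>)" using u(2) I_sub by blast
  then have "(\<sigma> u, \<sigma> v) \<in> U \<times> V" using v(2) x2(1) by auto
  moreover have "(u, v) \<in> fibre_rel X' \<phi>'" using u v(1) by (simp add: fibre_rel_def)
  then have "(\<sigma> u, \<sigma> v) \<in> map_prod \<sigma> \<sigma> ` fibre_rel X' \<phi>'" by (rule map_prod_imageI)
  ultimately show ?thesis by (metis IntI empty_iff)
qed

lemma fibre_rel_image_if_semi_open_fst:
  assumes mX': "minimal_flow S X' a'" and mZ': "minimal_flow S Z' b'"
    and \<sigma>: "extension S X' a' X a \<sigma>" and \<phi>': "extension S X' a' Z' b' \<phi>'" "open_map X' Z' \<phi>'"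
    and comm: "\<And>x. x \<in> topspace X' \<Longrightarrow> \<phi> (\<sigma> x) = \<tau> (\<phi>' x)"
    and hp: "highly_proximal S Z' b' Z b \<tau>"
    and so: "semi_open_map (fibre_rel_space X \<phi>) X fst"
  shows "map_prod \<sigma> \<sigma> ` fibre_rel X' \<phi>' = fibre_rel X \<phi>"
proof
  let ?Q = "map_prod \<sigma> \<sigma> ` fibre_rel X' \<phi>'"
  have c\<sigma>: "continuous_map X' X \<sigma>" "\<sigma> ` topspace X' = topspace X"
    and c\<phi>': "continuous_map X' Z' \<phi>'" "\<phi>' ` topspace X' = topspace Z'"
    and top: "Hausdorff_space X" "compact_space X'" "Hausdorff_space Z'"
    using \<sigma> \<phi>' unfolding extension_def flow_def by auto
  show "?Q \<subseteq> fibre_rel X \<phi>" using c\<sigma>(2) comm by (auto simp: fibre_rel_def)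
  have "continuous_map (prod_topology X' X') (prod_topology X X) (map_prod \<sigma> \<sigma>)"
    using c\<sigma>(1) by (simp add: map_prod_def continuous_map_prod_top)
  then have "compactin (prod_topology X X) ?Q"
    using image_compactin compactin_fibre_rel[OF top(2,3) c\<phi>'(1)] by blast
  then have Q: "closedin (prod_topology X X) ?Q"
    using top(1) by (simp add: compactin_imp_closedin Hausdorff_space_prod_topology)
  show "fibre_rel X \<phi> \<subseteq> ?Q"
  proof (rule ccontr)
    assume "\<not> ?thesis"
    then obtain x y where xy: "(x, y) \<in> fibre_rel X \<phi>" "(x, y) \<notin> ?Q" by auto
    have oQ: "openin (prod_topology X X) (topspace (prod_topology X X) - ?Q)" using Q by blast
    have "(x, y) \<in> topspace (prod_topology X X) - ?Q"
      using xy fibre_rel_subset[of X \<phi>] by blast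
    then obtain U V where UV: "openin X U" "openin X V" "x \<in> U" "y \<in> V"
      "U \<times> V \<subseteq> topspace (prod_topology X X) - ?Q"
      using oQ[unfolded openin_prod_topology_alt, rule_format, of x y] by auto
    then have ne: "(U \<times> V) \<inter> fibre_rel X \<phi> \<noteq> {}" using xy by blast
    have "(U \<times> V) \<inter> ?Q \<noteq> {}"
      by (rule fibre_rel_image_meets_box[OF mX' mZ' c\<sigma> c\<phi>' \<phi>'(2) _ hp so UV(1,2) ne]) (rule comm)
    then show False using UV(5) by blast
  qed
qed

theorem corollary3p9:
  fixes S :: "('s, 'm) monoid_scheme"
    and X :: "'x topology" and a :: "'s \<Rightarrow> 'x \<Rightarrow> 'x"
    and Z :: "'z topology" and b :: "'s \<Rightarrow> 'z \<Rightarrow> 'z"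
    and X' :: "'u topology" and a' :: "'s \<Rightarrow> 'u \<Rightarrow> 'u"
    and Z' :: "'v topology" and b' :: "'s \<Rightarrow> 'v \<Rightarrow> 'v"
    and \<phi> :: "'x \<Rightarrow> 'z" and \<phi>' :: "'u \<Rightarrow> 'v" and \<sigma> :: "'u \<Rightarrow> 'x" and \<tau> :: "'v \<Rightarrow> 'z"
  assumes "group S"
    and "minimal_flow S X a" and "minimal_flow S Z b"
    and "minimal_flow S X' a'" and "minimal_flow S Z' b'"
    and "extension S X a Z b \<phi>" and "extension S X' a' Z' b' \<phi>'"
    and "extension S X' a' X a \<sigma>" and "extension S Z' b' Z b \<tau>"
    and "\<And>x. x \<in> topspace X' \<Longrightarrow> \<phi> (\<sigma> x) = \<tau> (\<phi>' x)"
    and "highly_proximal S Z' b' Z b \<tau>"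
    and "open_map X' Z' \<phi>'"
  shows "(map_prod \<sigma> \<sigma> ` fibre_rel X' \<phi>' = fibre_rel X \<phi> \<longleftrightarrow>
            semi_open_map (fibre_rel_space X \<phi>) X fst) \<and>
         (open_map X Z \<phi> \<or>
            (\<exists>D \<subseteq> {p. almost_periodic S (fibre_rel_space X \<phi>) (diag_act a) p}.
               fibre_rel_space X \<phi> closure_of D = topspace (fibre_rel_space X \<phi>)) \<longrightarrow>
          map_prod \<sigma> \<sigma> ` fibre_rel X' \<phi>' = fibre_rel X \<phi>)"
proof -
  have c\<phi>: "continuous_map X Z \<phi>" and c\<phi>': "continuous_map X' Z' \<phi>'"
    using assms(6,7) by (auto simp: extension_def)
  have iff: "map_prod \<sigma> \<sigma> ` fibre_rel X' \<phi>' = fibre_rel X \<phi> \<longleftrightarrow>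
      semi_open_map (fibre_rel_space X \<phi>) X fst"
  proof
    assume "map_prod \<sigma> \<sigma> ` fibre_rel X' \<phi>' = fibre_rel X \<phi>"
    then show "semi_open_map (fibre_rel_space X \<phi>) X fst"
      by (rule semi_open_fst_if_fibre_rel_image[OF assms(2,4,8) c\<phi>' assms(12)])
  next
    assume so: "semi_open_map (fibre_rel_space X \<phi>) X fst"
    show "map_prod \<sigma> \<sigma> ` fibre_rel X' \<phi>' = fibre_rel X \<phi>"
      by (rule fibre_rel_image_if_semi_open_fst[OF assms(4,5,8,7,12) _ assms(11) so]) (rule assms(10))
  qed
  show ?thesis
    using iff semi_open_fst_if_open[OF c\<phi>] semi_open_fst_if_dense_almost_periodic[OF assms(2)]
    by blast
qed

end
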